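(* For every integer $d\ge2$ that is not a prime, there exists at least one $(d,\Pi)$ that is exceptional for branched covers $\mathbb S^2\to\mathbb S^2$.
   Context: A branched cover $f:\mathbb S^2\to\mathbb S^2$ of degree $d$ is a non-constant holomorphic map of the Riemann sphere of degree $d$. Near each point $q$ of the source it has, in suitable local holomorphic coordinates, the form $z\mapsto z^{e_q}$, where $e_q\in\mathbb N$ is the local ramification index. The branching points are the images of the points with $e_q\ge2$. A candidate branch datum $(d,\Pi)$ consists of $d\in\mathbb N$ and a list of $n$ tuples of positive integers $\Pi=[(\Pi_1^1,\dots,\Pi_1^{\ell_1}),\dots,(\Pi_n^1,\dots,\Pi_n^{\ell_n})]$ such that for each $i$ at least one $\Pi_i^j\ge2$, $\sum_j\Pi_i^j=d$ for each $i$, and $2=2d-\sum_{i=1}^n\sum_{j=1}^{\ell_i}(\Pi_i^j-1)$ (Riemann–Hurwitz). It is realized by a branched cover $f:\mathbb S^2\to\mathbb S^2$ of degree $d$ if $f$ has exactly $n$ distinct branching points $p_1,\dots,p_n$ and, for each $i$, the preimage $f^{-1}(p_i)$ consists of $\ell_i$ points with local ramification indices $\Pi_i^1,\dots,\Pi_i^{\ell_i}$ (up to order). The datum is exceptional if it is a candidate branch datum that is not realized by any branched cover $\mathbb S^2\to\mathbb S^2$. *)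

theory Defs
  imports "HOL-Complex_Analysis.Complex_Analysis" "HOL-Library.Multiset"
begin

type_synonym rsphere = "complex option"

definition rsphere :: "rsphere topology" where
  "rsphere = Alexandroff_compactification euclidean"

definition chart_fin :: "rsphere \<Rightarrow> complex" where
  "chart_fin = the"

definition chart_inf :: "rsphere \<Rightarrow> complex" where
  "chart_inf x = (case x of None \<Rightarrow> 0 | Some z \<Rightarrow> inverse z)"

definition rsphere_atlas :: "(rsphere set \<times> (rsphere \<Rightarrow> complex)) set" where
  "rsphere_atlas = {(range Some, chart_fin), (- {Some 0}, chart_inf)}"

lemma topspace_rsphere: "topspace rsphere = UNIV"
  unfolding rsphere_def by (auto simp: notin_range_Some)

lemma bij_betw_chart_fin: "bij_betw chart_fin (range Some) UNIV"
  by (auto simp: bij_betw_def inj_on_def chart_fin_def image_image)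

lemma bij_betw_chart_inf: "bij_betw chart_inf (- {Some 0}) UNIV"
proof (rule bij_betw_byWitness[where f' = "\<lambda>w. if w = 0 then None else Some (inverse w)"])
qed (auto simp: chart_inf_def split: option.splits)

text \<open>Meant for sets \<open>W\<close> that are open in the sphere.\<close>

definition rsphere_holomorphic_on :: "(rsphere \<Rightarrow> complex) \<Rightarrow> rsphere set \<Rightarrow> bool" where
  "rsphere_holomorphic_on h W \<longleftrightarrow>
     (\<forall>(U, \<phi>) \<in> rsphere_atlas. (h \<circ> inv_into U \<phi>) holomorphic_on \<phi> ` (W \<inter> U))"

definition holomorphic_rsphere_map :: "(rsphere \<Rightarrow> rsphere) \<Rightarrow> bool" where
  "holomorphic_rsphere_map f \<longleftrightarrow>
     continuous_map rsphere rsphere f \<and>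
     (\<forall>(V, \<psi>) \<in> rsphere_atlas. rsphere_holomorphic_on (\<psi> \<circ> f) (f -` V))"

text \<open>The inverse of an injective holomorphic function is holomorphic, so this need not
  be required of a local coordinate.\<close>

definition local_coordinate :: "rsphere \<Rightarrow> rsphere set \<Rightarrow> (rsphere \<Rightarrow> complex) \<Rightarrow> bool" where
  "local_coordinate q U u \<longleftrightarrow>
     openin rsphere U \<and> q \<in> U \<and> u q = 0 \<and> inj_on u U \<and> rsphere_holomorphic_on u U"

definition has_ramification_index :: "(rsphere \<Rightarrow> rsphere) \<Rightarrow> rsphere \<Rightarrow> nat \<Rightarrow> bool" where
  "has_ramification_index f q e \<longleftrightarrow>
     e \<ge> 1 \<and>
     (\<exists>U u V v. local_coordinate q U u \<and> local_coordinate (f q) V v \<and>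
        f ` U \<subseteq> V \<and> (\<forall>x\<in>U. v (f x) = u x ^ e))"

text \<open>For a non-constant holomorphic map the index exists and is unique at every point.\<close>

definition ramification_index :: "(rsphere \<Rightarrow> rsphere) \<Rightarrow> rsphere \<Rightarrow> nat" where
  "ramification_index f q = (THE e. has_ramification_index f q e)"

text \<open>The degree is the number of preimages of any point, counted with multiplicity.\<close>

definition has_degree :: "(rsphere \<Rightarrow> rsphere) \<Rightarrow> nat \<Rightarrow> bool" where
  "has_degree f d \<longleftrightarrow>
     (\<forall>p. finite (f -` {p}) \<and> (\<Sum>q\<in>f -` {p}. ramification_index f q) = d)"

definition branched_cover :: "(rsphere \<Rightarrow> rsphere) \<Rightarrow> nat \<Rightarrow> bool" where
  "branched_cover f d \<longleftrightarrow>
     holomorphic_rsphere_map f \<and> \<not> f constant_on UNIV \<and> has_degree f d"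

definition branching_points :: "(rsphere \<Rightarrow> rsphere) \<Rightarrow> rsphere set" where
  "branching_points f = f ` {q. ramification_index f q \<ge> 2}"

definition candidate_branch_datum :: "nat \<Rightarrow> nat list list \<Rightarrow> bool" where
  "candidate_branch_datum d D \<longleftrightarrow>
     (\<forall>\<mu> \<in> set D. (\<forall>m \<in> set \<mu>. m > 0) \<and> (\<exists>m \<in> set \<mu>. m \<ge> 2) \<and> sum_list \<mu> = d) \<and>
     (2 :: int) = 2 * int d - (\<Sum>\<mu>\<leftarrow>D. \<Sum>m\<leftarrow>\<mu>. int m - 1)"

definition realizes :: "(rsphere \<Rightarrow> rsphere) \<Rightarrow> nat \<Rightarrow> nat list list \<Rightarrow> bool" where
  "realizes f d D \<longleftrightarrow>
     branched_cover f d \<and>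
     (\<exists>ps. distinct ps \<and> set ps = branching_points f \<and> length ps = length D \<and>
        (\<forall>i < length D. finite (f -` {ps ! i}) \<and>
           image_mset (ramification_index f) (mset_set (f -` {ps ! i})) = mset (D ! i)))"

definition exceptional :: "nat \<Rightarrow> nat list list \<Rightarrow> bool" where
  "exceptional d D \<longleftrightarrow> candidate_branch_datum d D \<and> (\<nexists>f. realizes f d D)"

end

theory Submission
  imports Defs
begin

text \<open>
  A composite degree \<open>d = h k\<close> with \<open>h, k \<ge> 2\<close> has the exceptional datum
  \<open>(k,\<dots>,k), (k,\<dots>,k), (2h-1,1,\<dots>,1)\<close>
  with \<open>h\<close> entries in each of the first two tuples and \<open>h (k - 2) + 2\<close> entries in the third; the
  lengths add up to \<open>d + 2\<close>, as the Riemann--Hurwitz formula demands.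

  Suppose that a covering \<open>f\<close> realizes it. After a Moebius transformation of the target the first two
  branching points are \<open>0\<close> and infinity, so that every zero and every pole of \<open>f\<close> has order \<open>k\<close>. Then \<open>f\<close>
  is, up to a constant factor, the power \<open>g^k\<close> of a rational function \<open>g\<close> of degree \<open>h\<close>: take the
  zeros and poles of \<open>f\<close> as simple zeros and poles of \<open>g\<close>; the quotient of \<open>f\<close> by \<open>g^k\<close> is constant by Liouville's theorem
  (\<open>eq_constant_times_power\<close>). The power map is unramified away from \<open>0\<close> and infinity, so at a point over
  the third branching point \<open>f\<close> and \<open>g\<close> have the same index, and for \<open>g\<close> it is at most \<open>h\<close>
  (\<open>ramification_bound_over_third_point\<close>). But \<open>2 h - 1 > h\<close>.

  To keep the rational function a quotient of monic polynomials of the same degree \<open>h\<close>, the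
  source is also transformed, so that the point of index \<open>2 h - 1\<close> lies at infinity. The bound then
  becomes the statement that an entire function tending to \<open>0\<close> at infinity vanishes
  (\<open>monic_of_roots_eqI\<close>).

  The bridge from coverings to complex functions is \<open>ramification_index_expansion\<close>, which reads off an
  index as the order of a limit in any local coordinates. It applies at every point since the
  index exists (\<open>has_ramification_index_exists\<close>) and is unique (\<open>ramification_index_unique\<close>).
\<close>

section \<open>The sphere through two planes\<close>

text \<open>The inverse of the chart at infinity.\<close>

definition from_inf :: "complex \<Rightarrow> rsphere" where
  "from_inf w = (if w = 0 then None else Some (inverse w))"

text \<open>
  The inverses of the two charts of the atlas. Statements about the sphere are reduced to
  statements about the complex plane by pulling back along such a map.
\<close>

definition sphere_parametrization :: "(complex \<Rightarrow> rsphere) \<Rightarrow> bool" where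
  "sphere_parametrization \<kappa> \<longleftrightarrow> \<kappa> = Some \<or> \<kappa> = from_inf"

lemma inj_from_inf: "inj from_inf"
  by (auto simp: inj_def from_inf_def)

lemma range_from_inf: "range from_inf = - {Some 0}"
proof -
  have "x \<in> range from_inf" if "x \<noteq> Some 0" for x
  proof (cases x)
    case None
    then show ?thesis by (auto simp: from_inf_def intro!: image_eqI[of _ _ 0])
  next
    case (Some z)
    with that show ?thesis
      by (auto simp: from_inf_def intro!: image_eqI[of _ _ "inverse z"])
  qed
  then show ?thesis by (auto simp: from_inf_def split: if_splits)
qed

lemma inj_parametrization: "sphere_parametrization \<kappa> \<Longrightarrow> inj \<kappa>"
  by (auto simp: sphere_parametrization_def inj_from_inf)

lemma parametrization_covers: 
  obtains \<kappa> z where "sphere_parametrization \<kappa>" "x = \<kappa> z"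
proof (cases x)
  case None
  then have "x = from_inf 0" by (simp add: from_inf_def)
  then show ?thesis using that by (auto simp: sphere_parametrization_def)
next
  case (Some z)
  then show ?thesis using that by (auto simp: sphere_parametrization_def)
qed

lemma open_vimage_inverse:
  fixes S :: "complex set"
  assumes "open S"
  shows "open {w. w \<noteq> 0 \<and> inverse w \<in> S}"
proof -
  have "open ((inverse -` S) \<inter> (- {0}))"
    using assms by (subst Int_commute, intro continuous_open_preimage continuous_intros) auto
  moreover have "(inverse -` S) \<inter> (- {0}) = {w. w \<noteq> 0 \<and> inverse w \<in> S}" by auto
  ultimately show ?thesis by simp
qed

text \<open>
  The one-point compactification is thus glued from two planes: a neighbourhood of infinity is the
  complement of a compact set, that is, a set that contains the inverses of all small numbers.
\<close>

lemma openin_rsphere_iff: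
  "openin rsphere W \<longleftrightarrow> open (Some -` W) \<and> open (from_inf -` W)"
proof
  assume "openin rsphere W"
  then consider S where "open S" "W = Some ` S"
    | C where "compact C" "W = insert None (Some ` (- C))"
    by (auto simp: rsphere_def openin_Alexandroff_compactification Compl_eq_Diff_UNIV)
  then show "open (Some -` W) \<and> open (from_inf -` W)"
  proof cases
    case 1
    have "from_inf -` W = {w. w \<noteq> 0 \<and> inverse w \<in> S}" "Some -` W = S"
      using 1 by (auto simp: from_inf_def split: if_splits)
    then show ?thesis using 1 open_vimage_inverse[of S] by simp
  next
    case 2
    have oc: "open (- C)" using 2 by (simp add: compact_imp_closed open_Compl)
    obtain b where b: "b > 0" "\<And>z. z \<in> C \<Longrightarrow> norm z \<le> b"
      using compact_imp_bounded[OF \<open>compact C\<close>] by (auto simp: bounded_pos)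
    have "from_inf -` W = {w. w \<noteq> 0 \<and> inverse w \<in> - C} \<union> ball 0 (inverse b)"
    proof -
      have "inverse w \<notin> C" if "norm w < inverse b" "w \<noteq> 0" for w
      proof
        assume "inverse w \<in> C"
        then have "inverse (norm w) \<le> b" using b(2)[of "inverse w"] by (simp add: norm_inverse)
        then have "inverse b \<le> norm w"
          using that(2) b(1) le_imp_inverse_le[of "inverse (norm w)" b] by simp
        with that show False by simp
      qed
      then show ?thesis using 2 b by (auto simp: from_inf_def image_iff split: if_splits)
    qed
    moreover have "Some -` W = - C" using 2 by auto
    ultimately show ?thesis using oc open_vimage_inverse[OF oc] by auto
  qed
next
  assume o: "open (Some -` W) \<and> open (from_inf -` W)"
  show "openin rsphere W"
  proof (cases "None \<in> W")
    case False
    then have "W = Some ` (Some -` W)" by (auto simp: image_iff) (metis option.exhaust)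
    with o show ?thesis by (auto simp: rsphere_def openin_Alexandroff_compactification)
  next
    case True
    define C where "C = - (Some -` W)"
    have "0 \<in> from_inf -` W" using True by (simp add: from_inf_def)
    then obtain r where r: "r > 0" "ball 0 r \<subseteq> from_inf -` W"
      using o openE by blast
    have "norm z \<le> inverse r" if "z \<in> C" for z
    proof (rule ccontr)
      assume "\<not> norm z \<le> inverse r"
      then have a: "inverse r < norm z" by simp
      then have "z \<noteq> 0" using r by auto
      have "norm (inverse z) < r"
        using a r \<open>z \<noteq> 0\<close> by (metis inverse_inverse_eq inverse_positive_iff_positive less_imp_inverse_less norm_inverse)
      then have "from_inf (inverse z) \<in> W" using r by (auto simp: subset_iff)
      then show False using that \<open>z \<noteq> 0\<close> by (auto simp: C_def from_inf_def)
    qed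
    then have "bounded C" by (auto simp: bounded_iff)
    moreover have "closed C" using o by (auto simp: C_def)
    ultimately have "compact C" by (simp add: compact_eq_bounded_closed)
    moreover have "W = insert None (Some ` (UNIV - C))"
      using True by (auto simp: C_def image_iff)
    ultimately show ?thesis
      by (auto simp: rsphere_def openin_Alexandroff_compactification compact_imp_closed)
  qed
qed

lemma open_vimage_parametrization:
  "sphere_parametrization \<kappa> \<Longrightarrow> openin rsphere W \<Longrightarrow> open (\<kappa> -` W)"
  by (auto simp: sphere_parametrization_def openin_rsphere_iff)

lemma Some_vimage_from_inf_image: "Some -` from_inf ` S = {w. w \<noteq> 0 \<and> inverse w \<in> S}"
proof -
  have "Some w = from_inf (inverse w)" if "w \<noteq> 0" for w
    using that by (simp add: from_inf_def)
  then have "\<exists>v\<in>S. Some w = from_inf v" if "w \<noteq> 0" "inverse w \<in> S" for w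
    using that by blast
  moreover have "w \<noteq> 0 \<and> inverse w \<in> S" if "Some w = from_inf v" "v \<in> S" for w v
    using that by (auto simp: from_inf_def split: if_splits)
  ultimately show ?thesis by (auto simp: image_iff)
qed

lemma from_inf_vimage_Some_image: "from_inf -` Some ` S = {w. w \<noteq> 0 \<and> inverse w \<in> S}"
  by (auto simp: from_inf_def split: if_splits)

lemma openin_image_parametrization:
  assumes "sphere_parametrization \<kappa>" "open S"
  shows "openin rsphere (\<kappa> ` S)"
proof -
  have 1: "Some -` from_inf ` S = {w. w \<noteq> 0 \<and> inverse w \<in> S}"
    by (rule Some_vimage_from_inf_image)
  have 2: "from_inf -` Some ` S = {w. w \<noteq> 0 \<and> inverse w \<in> S}"
    by (rule from_inf_vimage_Some_image)
  have 3: "from_inf -` from_inf ` S = S" "Some -` Some ` S = S"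
    using inj_vimage_image_eq[OF inj_from_inf] by auto
  show ?thesis
    using assms open_vimage_inverse[of S] 1 2 3
    by (auto simp: sphere_parametrization_def openin_rsphere_iff)
qed

lemma openin_Compl_singleton: "openin rsphere (- {p})"
proof -
  have "\<kappa> -` (- {p}) = UNIV - {z. \<kappa> z = p}" for \<kappa> :: "complex \<Rightarrow> rsphere" by auto
  moreover have "open (UNIV - {z. \<kappa> z = p})" if "inj \<kappa>" for \<kappa> :: "complex \<Rightarrow> rsphere"
    using finite_vimageI[OF _ that, of "{p}"]
    by (intro open_Diff finite_imp_closed) (auto simp: vimage_def)
  ultimately show ?thesis 
    by (auto simp: openin_rsphere_iff inj_from_inf)
qed

text \<open>Limits on the sphere become limits in the plane.\<close>

lemma atin_rsphere_parametrization:
  assumes "sphere_parametrization \<kappa>"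
  shows "atin rsphere (\<kappa> z) = filtermap \<kappa> (at z)"
proof (rule filter_eqI)
  fix P
  show "eventually P (atin rsphere (\<kappa> z)) \<longleftrightarrow> eventually P (filtermap \<kappa> (at z))"
  proof
    assume "eventually P (atin rsphere (\<kappa> z))"
    then obtain W where W: "openin rsphere W" "\<kappa> z \<in> W" "\<forall>x\<in>W - {\<kappa> z}. P x"
      by (auto simp: eventually_atin topspace_rsphere)
    show "eventually P (filtermap \<kappa> (at z))"
      unfolding eventually_filtermap eventually_at_topological
      using W open_vimage_parametrization[OF assms W(1)] inj_parametrization[OF assms]
      by (intro exI[of _ "\<kappa> -` W"]) (auto simp: inj_eq)
  next
    assume "eventually P (filtermap \<kappa> (at z))"
    then obtain S where S: "open S" "z \<in> S" "\<forall>w\<in>S. w \<noteq> z \<longrightarrow> P (\<kappa> w)"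
      by (auto simp: eventually_filtermap eventually_at_topological)
    show "eventually P (atin rsphere (\<kappa> z))"
      unfolding eventually_atin
      using S openin_image_parametrization[OF assms S(1)]
      by (intro disjI2 exI[of _ "\<kappa> ` S"]) auto
  qed
qed

lemma atin_rsphere_neq_bot: "atin rsphere x \<noteq> bot"
proof -
  obtain \<kappa> z where "sphere_parametrization \<kappa>" "x = \<kappa> z" by (rule parametrization_covers)
  then show ?thesis by (simp add: atin_rsphere_parametrization filtermap_bot_iff)
qed

lemma rsphere_holomorphic_on_iff:
  "rsphere_holomorphic_on h W \<longleftrightarrow>
     (h \<circ> Some) holomorphic_on (Some -` W) \<and> (h \<circ> from_inf) holomorphic_on (from_inf -` W)"
proof -
  have fin: "inv_into (range Some) chart_fin z = Some z" for z
    by (rule inv_into_f_eq) (auto simp: chart_fin_def inj_on_def)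
  have inf: "inv_into (- {Some 0}) chart_inf w = from_inf w" for w
    using bij_betw_chart_inf
    by (intro inv_into_f_eq) (auto simp: chart_inf_def from_inf_def bij_betw_def)
  have "chart_fin ` (W \<inter> range Some) = Some -` W"
    unfolding image_vimage_eq[symmetric] by (simp only: image_image chart_fin_def option.sel image_ident)
  moreover have "chart_inf ` (W \<inter> - {Some 0}) = from_inf -` W"
  proof -
    have "chart_inf (from_inf w) = w" for w by (auto simp: chart_inf_def from_inf_def)
    then have "chart_inf ` from_inf ` (from_inf -` W) = from_inf -` W"
      unfolding image_image by simp
    then show ?thesis unfolding image_vimage_eq range_from_inf .
  qed
  ultimately show ?thesis
    by (simp add: rsphere_holomorphic_on_def rsphere_atlas_def fin inf comp_def)
qed

lemma holomorphic_vimage_parametrization: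
  "sphere_parametrization \<kappa> \<Longrightarrow> rsphere_holomorphic_on h W \<Longrightarrow> (h \<circ> \<kappa>) holomorphic_on (\<kappa> -` W)"
  by (auto simp: sphere_parametrization_def rsphere_holomorphic_on_iff)

text \<open>One chart suffices to test holomorphy, because the transition map \<open>inverse\<close> is holomorphic.\<close>

lemma rsphere_holomorphic_on_image:
  assumes "sphere_parametrization \<kappa>" "(h \<circ> \<kappa>) holomorphic_on S"
  shows "rsphere_holomorphic_on h (\<kappa> ` S)"
proof -
  define T where "T = {w. w \<noteq> 0 \<and> inverse w \<in> S}"
  have T: "Some -` from_inf ` S = T" "from_inf -` Some ` S = T"
    by (simp_all add: T_def Some_vimage_from_inf_image from_inf_vimage_Some_image)
  have e: "from_inf -` from_inf ` S = S" "Some -` Some ` S = S"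
    using inj_vimage_image_eq[OF inj_from_inf] by auto
  have "((h \<circ> \<kappa>) \<circ> inverse) holomorphic_on T"
    using assms(2) by (intro holomorphic_on_compose_gen[where t = S]) (auto intro!: holomorphic_intros simp: T_def)
  then have t: "(\<lambda>w. h (\<kappa> (inverse w))) holomorphic_on T" by (simp add: comp_def)
  show ?thesis
  proof (cases "\<kappa> = Some")
    case True
    have "(h \<circ> from_inf) holomorphic_on T"
      by (rule holomorphic_transform[OF t]) (auto simp: True T_def from_inf_def)
    then show ?thesis using assms(2) by (simp add: rsphere_holomorphic_on_iff True T e)
  next
    case False
    then have \<kappa>: "\<kappa> = from_inf" using assms by (auto simp: sphere_parametrization_def)
    have "(h \<circ> Some) holomorphic_on T"
      by (rule holomorphic_transform[OF t]) (auto simp: \<kappa> T_def from_inf_def)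
    then show ?thesis using assms(2) by (simp add: rsphere_holomorphic_on_iff \<kappa> T e)
  qed
qed

lemma atlas_parametrization:
  assumes "sphere_parametrization \<kappa>"
  obtains \<psi> where "(range \<kappa>, \<psi>) \<in> rsphere_atlas" "\<And>z. \<psi> (\<kappa> z) = z"
proof (cases "\<kappa> = Some")
  case True
  then show ?thesis using that[of chart_fin] by (auto simp: rsphere_atlas_def chart_fin_def)
next
  case False
  then have \<kappa>: "\<kappa> = from_inf" using assms by (auto simp: sphere_parametrization_def)
  show ?thesis using that[of chart_inf]
    by (simp add: \<kappa> rsphere_atlas_def range_from_inf) (simp add: chart_inf_def from_inf_def)
qed

section \<open>Local coordinates compared with each other\<close>

lemma local_coordinate_nonzero: "local_coordinate x U u \<Longrightarrow> y \<in> U \<Longrightarrow> y \<noteq> x \<Longrightarrow> u y \<noteq> 0"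
  by (metis inj_onD local_coordinate_def)

lemma eventually_atin_rsphereI:
  "openin rsphere U \<Longrightarrow> x \<in> U \<Longrightarrow> (\<And>y. y \<in> U \<Longrightarrow> y \<noteq> x \<Longrightarrow> P y) \<Longrightarrow> eventually P (atin rsphere x)"
  by (auto simp: eventually_atin)

text \<open>
  An injective holomorphic function has nonzero derivative, so in a plane chart a local
  coordinate has a simple zero.
\<close>

lemma local_coordinate_tendsto_slope:
  assumes \<kappa>: "sphere_parametrization \<kappa>" and u: "local_coordinate (\<kappa> z) U u"
  obtains c where "c \<noteq> 0" "((\<lambda>w. u (\<kappa> w) / (w - z)) \<longlongrightarrow> c) (at z)"
proof -
  define g where "g = u \<circ> \<kappa>"
  have o: "open (\<kappa> -` U)" and z: "z \<in> \<kappa> -` U"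
    using \<kappa> u by (auto simp: local_coordinate_def open_vimage_parametrization)
  have g: "g holomorphic_on (\<kappa> -` U)"
    using \<kappa> u by (simp add: g_def local_coordinate_def holomorphic_vimage_parametrization)
  have i: "inj_on g (\<kappa> -` U)"
    using inj_parametrization[OF \<kappa>] u
    by (auto simp: g_def local_coordinate_def inj_on_def)
  have "(g has_field_derivative deriv g z) (at z)"
    using g o z holomorphic_derivI by blast
  then have "((\<lambda>w. u (\<kappa> w) / (w - z)) \<longlongrightarrow> deriv g z) (at z)"
    using u by (simp add: has_field_derivative_iff g_def local_coordinate_def)
  moreover have "deriv g z \<noteq> 0" by (rule holomorphic_injective_imp_regular[OF g o i z])
  ultimately show ?thesis using that by blast
qed

text \<open>
  Both coordinates have a simple zero at the point. This makes the order of a map independent of the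
  coordinates in which it is read off.
\<close>

lemma local_coordinate_ratio:
  assumes "local_coordinate x U u" "local_coordinate x V v"
  obtains L where "L \<noteq> 0" "((\<lambda>y. v y / u y) \<longlongrightarrow> L) (atin rsphere x)"
proof -
  obtain \<kappa> z where \<kappa>: "sphere_parametrization \<kappa>" and x: "x = \<kappa> z" by (rule parametrization_covers)
  obtain c where c: "c \<noteq> 0" "((\<lambda>w. u (\<kappa> w) / (w - z)) \<longlongrightarrow> c) (at z)"
    using local_coordinate_tendsto_slope[OF \<kappa>] assms x by blast
  obtain d where d: "d \<noteq> 0" "((\<lambda>w. v (\<kappa> w) / (w - z)) \<longlongrightarrow> d) (at z)"
    using local_coordinate_tendsto_slope[OF \<kappa>] assms x by blast
  have "((\<lambda>w. (v (\<kappa> w) / (w - z)) / (u (\<kappa> w) / (w - z))) \<longlongrightarrow> d / c) (at z)"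
    by (intro tendsto_intros c d)
  then have "((\<lambda>w. v (\<kappa> w) / u (\<kappa> w)) \<longlongrightarrow> d / c) (at z)"
    by (rule Lim_transform_eventually) (auto simp: eventually_at_filter divide_simps)
  then have "((\<lambda>y. v y / u y) \<longlongrightarrow> d / c) (atin rsphere x)"
    by (simp add: x atin_rsphere_parametrization[OF \<kappa>] filterlim_filtermap)
  then show ?thesis using that[of "d / c"] c d by simp
qed

lemma local_coordinate_tendsto:
  assumes "local_coordinate x U u"
  shows "filterlim u (at 0) (atin rsphere x)"
proof -
  obtain \<kappa> z where \<kappa>: "sphere_parametrization \<kappa>" and x: "x = \<kappa> z" by (rule parametrization_covers)
  obtain c where c: "((\<lambda>w. u (\<kappa> w) / (w - z)) \<longlongrightarrow> c) (at z)"
    using local_coordinate_tendsto_slope[OF \<kappa>] assms x by blast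
  have "((\<lambda>w. u (\<kappa> w) / (w - z) * (w - z)) \<longlongrightarrow> c * (z - z)) (at z)"
    by (intro tendsto_intros c)
  then have "((\<lambda>w. u (\<kappa> w)) \<longlongrightarrow> 0) (at z)"
    unfolding diff_self mult_zero_right
    by (rule Lim_transform_eventually) (auto simp: eventually_at_filter)
  then have "(u \<longlongrightarrow> 0) (atin rsphere x)"
    by (simp add: x atin_rsphere_parametrization[OF \<kappa>] filterlim_filtermap)
  moreover have "eventually (\<lambda>y. u y \<noteq> 0) (atin rsphere x)"
    using assms local_coordinate_nonzero[OF assms]
    by (intro eventually_atin_rsphereI[of U]) (auto simp: local_coordinate_def)
  ultimately show ?thesis by (simp add: filterlim_at)
qed

lemma local_coordinate_open_image:
  assumes u: "local_coordinate x U u" and W: "openin rsphere W"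
  shows "open (u ` (W \<inter> U))"
proof -
  have "open ((u \<circ> \<kappa>) ` (\<kappa> -` (W \<inter> U)))" if \<kappa>: "sphere_parametrization \<kappa>" for \<kappa>
  proof (rule open_mapping_thm3)
    have "(u \<circ> \<kappa>) holomorphic_on (\<kappa> -` U)"
      using \<kappa> u by (simp add: local_coordinate_def holomorphic_vimage_parametrization)
    then show "(u \<circ> \<kappa>) holomorphic_on (\<kappa> -` (W \<inter> U))" by (rule holomorphic_on_subset) auto
    show "open (\<kappa> -` (W \<inter> U))"
      using u W by (intro open_vimage_parametrization[OF \<kappa>] openin_Int) (auto simp: local_coordinate_def)
    show "inj_on (u \<circ> \<kappa>) (\<kappa> -` (W \<inter> U))"
      using inj_parametrization[OF \<kappa>] u by (auto simp: local_coordinate_def inj_on_def)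
  qed
  then have "open ((u \<circ> Some) ` (Some -` (W \<inter> U)) \<union> (u \<circ> from_inf) ` (from_inf -` (W \<inter> U)))"
    by (intro open_Un) (auto simp: sphere_parametrization_def)
  also have "(u \<circ> Some) ` (Some -` (W \<inter> U)) \<union> (u \<circ> from_inf) ` (from_inf -` (W \<inter> U))
      = u ` (W \<inter> U \<inter> (range Some \<union> range from_inf))"
    by (simp only: image_comp[symmetric] image_vimage_eq image_Un[symmetric] Int_Un_distrib)
  also have "range Some \<union> range from_inf = UNIV"
    by (auto simp: range_from_inf)
  finally show ?thesis by simp
qed

text \<open>The open mapping theorem makes the inverse of a local coordinate continuous.\<close>

lemma local_coordinate_inverse_tendsto:
  assumes u: "local_coordinate x U u"
  shows "filterlim (inv_into U u) (atin rsphere x) (at 0)"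
  unfolding filterlim_iff
proof (intro allI impI)
  fix P assume "eventually P (atin rsphere x)"
  then obtain W where W: "openin rsphere W" "x \<in> W" "\<forall>y\<in>W - {x}. P y"
    by (auto simp: eventually_atin topspace_rsphere)
  have "0 \<in> u ` (W \<inter> U)" using u W by (force simp: local_coordinate_def)
  moreover have "P (inv_into U u t)" if "t \<in> u ` (W \<inter> U)" "t \<noteq> 0" for t
  proof -
    obtain y where y: "y \<in> W" "y \<in> U" "t = u y" using \<open>t \<in> _\<close> by auto
    then have "inv_into U u t = y" "y \<noteq> x" using u that by (auto simp: local_coordinate_def)
    then show ?thesis using W y by auto
  qed
  ultimately show "\<forall>\<^sub>F t in at 0. P (inv_into U u t)"
    unfolding eventually_at_topological
    using local_coordinate_open_image[OF u W(1)] by blast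
qed

section \<open>Ramification indices as orders of contact\<close>

text \<open>
  In the coordinates of the normal form the map is exactly a power; passing to the given
  coordinates \<open>\<alpha>\<close> and \<open>\<beta>\<close> changes numerator and denominator by factors with nonzero limits.
  So an index can be read off in whatever coordinates are convenient.
\<close>

lemma ramification_index_expansion:
  assumes cont: "continuous_map rsphere rsphere f"
    and ind: "has_ramification_index f x e"
    and \<alpha>: "local_coordinate x A \<alpha>" and \<beta>: "local_coordinate (f x) B \<beta>"
  obtains L where "L \<noteq> 0" "((\<lambda>y. \<beta> (f y) / \<alpha> y ^ e) \<longlongrightarrow> L) (atin rsphere x)"
proof -
  obtain U u V v where u: "local_coordinate x U u" and v: "local_coordinate (f x) V v"
    and fU: "f ` U \<subseteq> V" and pow: "\<And>y. y \<in> U \<Longrightarrow> v (f y) = u y ^ e"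
    using ind by (auto simp: has_ramification_index_def)
  have U: "openin rsphere U" "x \<in> U" using u by (auto simp: local_coordinate_def)
  have neq: "f y \<noteq> f x" if "y \<in> U" "y \<noteq> x" for y
    using pow[OF \<open>y \<in> U\<close>] local_coordinate_nonzero[OF u that] v by (auto simp: local_coordinate_def)
  have f: "filterlim f (atin rsphere (f x)) (atin rsphere x)"
    unfolding filterlim_iff
  proof (intro allI impI)
    fix P assume "eventually P (atin rsphere (f x))"
    then obtain W where W: "openin rsphere W" "f x \<in> W" "\<forall>y\<in>W - {f x}. P y"
      by (auto simp: eventually_atin topspace_rsphere)
    have "openin rsphere {y \<in> topspace rsphere. f y \<in> W}"
      using cont W(1) by (rule openin_continuous_map_preimage)
    then have "openin rsphere ({y. f y \<in> W} \<inter> U)"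
      using U by (intro openin_Int) (auto simp: topspace_rsphere)
    then show "\<forall>\<^sub>F y in atin rsphere x. P (f y)"
      using W U neq by (intro eventually_atin_rsphereI[of "{y. f y \<in> W} \<inter> U"]) auto
  qed
  obtain M where M: "M \<noteq> 0" "((\<lambda>y. \<beta> y / v y) \<longlongrightarrow> M) (atin rsphere (f x))"
    by (rule local_coordinate_ratio[OF v \<beta>])
  obtain N where N: "N \<noteq> 0" "((\<lambda>y. u y / \<alpha> y) \<longlongrightarrow> N) (atin rsphere x)"
    by (rule local_coordinate_ratio[OF \<alpha> u])
  have "((\<lambda>y. \<beta> (f y) / v (f y) * (u y / \<alpha> y) ^ e) \<longlongrightarrow> M * N ^ e) (atin rsphere x)"
    by (intro tendsto_intros N filterlim_compose[OF M(2) f])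
  moreover have "\<forall>\<^sub>F y in atin rsphere x. \<beta> (f y) / v (f y) * (u y / \<alpha> y) ^ e = \<beta> (f y) / \<alpha> y ^ e"
    using U
  proof (rule eventually_atin_rsphereI)
    fix y assume "y \<in> U" "y \<noteq> x"
    then have "u y \<noteq> 0" "v (f y) = u y ^ e"
      using local_coordinate_nonzero[OF u] pow by auto
    then show "\<beta> (f y) / v (f y) * (u y / \<alpha> y) ^ e = \<beta> (f y) / \<alpha> y ^ e"
      by (simp add: power_divide)
  qed
  ultimately have "((\<lambda>y. \<beta> (f y) / \<alpha> y ^ e) \<longlongrightarrow> M * N ^ e) (atin rsphere x)"
    by (rule Lim_transform_eventually)
  then show ?thesis using that[of "M * N ^ e"] M N by simp
qed

lemma ramification_index_unique:
  assumes cont: "continuous_map rsphere rsphere f"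
    and "has_ramification_index f x d" "has_ramification_index f x e"
  shows "d = e"
proof -
  have False if de: "d < e" and d: "has_ramification_index f x d" and e: "has_ramification_index f x e" for d e
  proof -
    obtain U u V v where u: "local_coordinate x U u" and v: "local_coordinate (f x) V v"
      using d by (auto simp: has_ramification_index_def)
    obtain M where M: "M \<noteq> 0" "((\<lambda>y. v (f y) / u y ^ d) \<longlongrightarrow> M) (atin rsphere x)"
      by (rule ramification_index_expansion[OF cont d u v])
    obtain N where N: "((\<lambda>y. v (f y) / u y ^ e) \<longlongrightarrow> N) (atin rsphere x)"
      by (rule ramification_index_expansion[OF cont e u v])
    have u0: "(u \<longlongrightarrow> 0) (atin rsphere x)" "\<forall>\<^sub>F y in atin rsphere x. u y \<noteq> 0"
      using local_coordinate_tendsto[OF u] by (auto simp: filterlim_at)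
    have "((\<lambda>y. v (f y) / u y ^ e * u y ^ (e - d)) \<longlongrightarrow> N * 0 ^ (e - d)) (atin rsphere x)"
      by (intro tendsto_intros N u0)
    moreover have "\<forall>\<^sub>F y in atin rsphere x. v (f y) / u y ^ e * u y ^ (e - d) = v (f y) / u y ^ d"
      by (rule eventually_mono[OF u0(2)]) (use de in \<open>simp add: power_diff\<close>)
    ultimately have "((\<lambda>y. v (f y) / u y ^ d) \<longlongrightarrow> N * 0 ^ (e - d)) (atin rsphere x)"
      by (rule Lim_transform_eventually)
    then have "N * 0 ^ (e - d) = M"
      using M(2) atin_rsphere_neq_bot tendsto_unique by blast
    with M(1) de show False by (simp add: power_0_left)
  qed
  then show ?thesis using assms by (meson linorder_neqE_nat)
qed

text \<open>
  The first nonvanishing derivative has some order \<open>e\<close>, and dividing by \<open>(w - z)^e\<close> leaves a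
  nonvanishing function with an \<open>e\<close>-th root. Hence the root \<open>h\<close> has a simple zero and is injective near
  it: it is the local coordinate in which \<open>g\<close> becomes a power.
\<close>

lemma nonconstant_holomorphic_root_of_zero:
  assumes g: "g holomorphic_on S" and S: "open S" "z \<in> S"
    and nonconst: "\<And>r. r > 0 \<Longrightarrow> \<exists>w\<in>ball z r. g w \<noteq> g z"
  obtains e r h where "e \<ge> 1" "r > 0" "ball z r \<subseteq> S" "h holomorphic_on ball z r"
    "h z = 0" "inj_on h (ball z r)" "\<And>w. w \<in> ball z r \<Longrightarrow> g w - g z = h w ^ e"
proof -
  obtain s where s: "s > 0" "ball z s \<subseteq> S" using S openE by blast
  have gs: "g holomorphic_on ball z s" using g s holomorphic_on_subset by blast
  have "\<exists>n>0. (deriv ^^ n) g z \<noteq> 0"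
  proof (rule ccontr)
    assume "\<not> ?thesis"
    then have zero: "(deriv ^^ n) g z = 0" if "n > 0" for n using that by blast
    have "g w = g z" if "w \<in> ball z s" for w
      by (rule holomorphic_fun_eq_const_on_connected[OF gs]) (use that s zero in auto)
    then show False using nonconst[OF s(1)] by blast
  qed
  then obtain n where n: "n > 0" "(deriv ^^ n) g z \<noteq> 0" 
    and min: "\<And>i. 0 < i \<Longrightarrow> i < n \<Longrightarrow> (deriv ^^ i) g z = 0"
    using exists_least_iff[of "\<lambda>n. n > 0 \<and> (deriv ^^ n) g z \<noteq> 0"] by blast
  obtain G t where t: "t > 0" "G holomorphic_on ball z t"
    "\<And>w. w \<in> ball z t \<Longrightarrow> g w - g z = ((w - z) * G w) ^ n"
    "\<And>w. w \<in> ball z t \<Longrightarrow> G w \<noteq> 0"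
    using holomorphic_factor_order_of_zero_strong[OF g S n min] by metis
  define h where "h w = (w - z) * G w" for w
  have h: "h holomorphic_on ball z t"
    unfolding h_def by (intro holomorphic_intros t)
  have "(G has_field_derivative deriv G z) (at z)"
    using t holomorphic_derivI by (metis centre_in_ball open_ball)
  then have "(h has_field_derivative G z) (at z)"
    unfolding h_def by (auto intro!: derivative_eq_intros)
  then have "deriv h z \<noteq> 0" using t by (auto dest: DERIV_imp_deriv)
  then obtain r where r: "r > 0" "ball z r \<subseteq> ball z t" "inj_on h (ball z r)"
    using has_complex_derivative_locally_injective[OF h _ open_ball, of z] t by auto
  show ?thesis
  proof (rule that[of n "min r s" h])
    show "ball z (min r s) \<subseteq> S" using s by auto
    have sub: "ball z (min r s) \<subseteq> ball z t" using r by auto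
    show "h holomorphic_on ball z (min r s)" using h sub holomorphic_on_subset by blast
    show "inj_on h (ball z (min r s))" using r(3) by (rule inj_on_subset) auto
    show "g w - g z = h w ^ n" if "w \<in> ball z (min r s)" for w
      using t(3) that sub by (auto simp: h_def)
  qed (use n r s in \<open>auto simp: h_def\<close>)
qed

text \<open>
  Finiteness of the fibre keeps the map from being constant near the point, so that its
  expression in charts has a zero of finite order.
\<close>

lemma has_ramification_index_exists:
  assumes hol: "holomorphic_rsphere_map f" and fin: "finite (f -` {f x})"
  shows "\<exists>e. has_ramification_index f x e"
proof -
  obtain \<kappa> z where \<kappa>: "sphere_parametrization \<kappa>" and x: "x = \<kappa> z" by (rule parametrization_covers)
  obtain \<eta> y where \<eta>: "sphere_parametrization \<eta>" and y: "f x = \<eta> y" by (rule parametrization_covers)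
  obtain \<phi> where \<phi>: "\<And>w. \<phi> (\<kappa> w) = w" using atlas_parametrization[OF \<kappa>] by metis
  obtain \<psi> where \<psi>: "(range \<eta>, \<psi>) \<in> rsphere_atlas" "\<And>w. \<psi> (\<eta> w) = w"
    using atlas_parametrization[OF \<eta>] by metis
  have \<eta>\<psi>: "\<eta> (\<psi> p) = p" if "p \<in> range \<eta>" for p using that \<psi> by auto
  define S where "S = \<kappa> -` (f -` range \<eta>)"
  define g where "g = (\<psi> \<circ> f) \<circ> \<kappa>"
  have "rsphere_holomorphic_on (\<psi> \<circ> f) (f -` range \<eta>)"
    using hol \<psi> by (auto simp: holomorphic_rsphere_map_def)
  then have g: "g holomorphic_on S"
    unfolding g_def S_def by (rule holomorphic_vimage_parametrization[OF \<kappa>])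
  have "openin rsphere {p \<in> topspace rsphere. f p \<in> range \<eta>}"
    using hol openin_image_parametrization[OF \<eta>, of UNIV]
    by (intro openin_continuous_map_preimage[of rsphere rsphere]) (auto simp: holomorphic_rsphere_map_def)
  then have "openin rsphere (f -` range \<eta>)" by (simp add: topspace_rsphere vimage_def)
  then have S: "open S" "z \<in> S"
    using x y open_vimage_parametrization[OF \<kappa>] by (auto simp: S_def)
  have nonconst: "\<exists>w\<in>ball z r. g w \<noteq> g z" if "r > 0" for r
  proof (rule ccontr)
    assume const: "\<not> ?thesis"
    obtain t where t: "t > 0" "ball z t \<subseteq> S" using S openE by blast
    have "f (\<kappa> w) = f x" if "w \<in> ball z (min r t)" for w
    proof -
      have "w \<in> S" "g w = g z" using that const t by auto
      then have "\<eta> (\<psi> (f (\<kappa> w))) = f (\<kappa> w)" "\<eta> (\<psi> (f (\<kappa> z))) = f (\<kappa> z)"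
        using S(2) by (auto intro!: \<eta>\<psi> simp only: S_def vimage_eq)
      moreover have "\<psi> (f (\<kappa> w)) = \<psi> (f (\<kappa> z))" using \<open>g w = g z\<close> by (simp only: g_def comp_apply)
      ultimately show ?thesis unfolding x by metis
    qed
    then have "ball z (min r t) \<subseteq> \<kappa> -` (f -` {f x})" by auto
    moreover have "finite (\<kappa> -` (f -` {f x}))"
      using fin inj_parametrization[OF \<kappa>] by (rule finite_vimageI)
    ultimately have "finite (ball z (min r t))" by (rule finite_subset)
    then show False using \<open>r > 0\<close> t(1) uncountable_ball[of "min r t" z] countable_finite[of "ball z (min r t)"] by simp
  qed
  obtain e r h where e: "e \<ge> 1" and r: "r > 0" "ball z r \<subseteq> S" and h: "h holomorphic_on ball z r"
    "h z = 0" "inj_on h (ball z r)" and pow: "\<And>w. w \<in> ball z r \<Longrightarrow> g w - g z = h w ^ e"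
    by (rule nonconstant_holomorphic_root_of_zero[OF g S nonconst]) (assumption, blast intro: that)
  have "local_coordinate x (\<kappa> ` ball z r) (h \<circ> \<phi>)"
    unfolding local_coordinate_def
  proof (intro conjI)
    show "openin rsphere (\<kappa> ` ball z r)" using \<kappa> by (rule openin_image_parametrization) simp
    show "rsphere_holomorphic_on (h \<circ> \<phi>) (\<kappa> ` ball z r)"
      using h \<kappa> by (intro rsphere_holomorphic_on_image) (simp_all add: comp_def \<phi>)
  qed (use h r in \<open>auto simp: x \<phi> inj_on_def\<close>)
  moreover have "local_coordinate (f x) (range \<eta>) (\<lambda>p. \<psi> p - y)"
    unfolding local_coordinate_def
  proof (intro conjI)
    show "openin rsphere (range \<eta>)" using \<eta> by (rule openin_image_parametrization) simp
    show "rsphere_holomorphic_on (\<lambda>p. \<psi> p - y) (range \<eta>)"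
      using \<eta> by (intro rsphere_holomorphic_on_image) (auto simp add: comp_def \<psi> intro!: holomorphic_intros)
  qed (auto simp: y \<psi> inj_on_def)
  moreover have "f ` \<kappa> ` ball z r \<subseteq> range \<eta>" using r by (auto simp: S_def)
  moreover have "\<forall>p\<in>\<kappa> ` ball z r. \<psi> (f p) - y = (h \<circ> \<phi>) p ^ e"
  proof safe
    fix w assume "w \<in> ball z r"
    then show "\<psi> (f (\<kappa> w)) - y = (h \<circ> \<phi>) (\<kappa> w) ^ e"
      using pow[of w] by (simp add: \<phi> g_def \<psi> y flip: x)
  qed
  ultimately show ?thesis using e unfolding has_ramification_index_def by blast
qed

lemma ramification_index_works:
  assumes "branched_cover f d"
  shows "has_ramification_index f x (ramification_index f x)"
proof -
  have cont: "continuous_map rsphere rsphere f"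
    and "\<exists>e. has_ramification_index f x e"
    using assms has_ramification_index_exists
    by (auto simp: branched_cover_def has_degree_def holomorphic_rsphere_map_def)
  then have "\<exists>!e. has_ramification_index f x e"
    using ramification_index_unique[OF cont] by blast
  then show ?thesis unfolding ramification_index_def by (rule theI')
qed

section \<open>Moebius coordinates\<close>

text \<open>
  Homogeneous coordinates: a finite point \<open>z\<close> is \<open>[z : 1]\<close> and infinity is \<open>[1 : 0]\<close>. With them
  the Moebius transformations below need no case distinction for the point at infinity.
\<close>

definition hnum :: "rsphere \<Rightarrow> complex" where "hnum x = (case x of None \<Rightarrow> 1 | Some z \<Rightarrow> z)"
definition hden :: "rsphere \<Rightarrow> complex" where "hden x = (case x of None \<Rightarrow> 0 | Some z \<Rightarrow> 1)"
definition bracket :: "rsphere \<Rightarrow> rsphere \<Rightarrow> complex" where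
  "bracket x y = hnum x * hden y - hnum y * hden x"
text \<open>
  The Moebius transformation that sends \<open>a\<close> to \<open>0\<close> and \<open>b\<close> to infinity. It serves both as a
  coordinate on the target, to turn a covering into a complex function, and on the source, to place a
  chosen point at infinity.
\<close>

definition moebius_coord :: "rsphere \<Rightarrow> rsphere \<Rightarrow> rsphere \<Rightarrow> complex" where
  "moebius_coord a b x = bracket x a / bracket x b"

lemma bracket_eq_0_iff [simp]: "bracket x y = 0 \<longleftrightarrow> x = y"
  by (cases x; cases y) (auto simp: bracket_def hnum_def hden_def)

lemma moebius_coord_self [simp]: "moebius_coord a b a = 0"
  by (simp add: moebius_coord_def)

lemma moebius_coord_eq_0_iff [simp]: "x \<noteq> b \<Longrightarrow> moebius_coord a b x = 0 \<longleftrightarrow> x = a"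
  by (simp add: moebius_coord_def)

lemma moebius_coord_swap: "moebius_coord b a x = inverse (moebius_coord a b x)"
  by (simp add: moebius_coord_def)

text \<open>The Pluecker identity for the \<open>2 \<times> 2\<close> determinants \<open>bracket\<close>.\<close>

lemma inj_on_moebius_coord:
  assumes "a \<noteq> b" shows "inj_on (moebius_coord a b) (- {b})"
proof (rule inj_onI)
  fix x y assume "x \<in> - {b}" "y \<in> - {b}" "moebius_coord a b x = moebius_coord a b y"
  then have "bracket x a * bracket y b - bracket y a * bracket x b = 0"
    by (simp add: moebius_coord_def divide_simps)
  moreover have "bracket x a * bracket y b - bracket y a * bracket x b = bracket x y * bracket a b"
    by (simp add: bracket_def algebra_simps)
  ultimately show "x = y" using assms by simp
qed

lemma surj_moebius_coord:
  assumes "a \<noteq> b" obtains x where "x \<noteq> b" "moebius_coord a b x = z"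
proof -
  \<comment> \<open>The vector \<open>a - z b\<close>, written in homogeneous coordinates, represents the solution.\<close>
  define n m where "n = hnum a - z * hnum b" and "m = hden a - z * hden b"
  define x where "x = (if m = 0 then None else Some (n / m))"
  have ab: "n * hden b - hnum b * m = bracket a b" "n * hden a - hnum a * m = z * bracket a b"
    by (simp_all add: n_def m_def bracket_def algebra_simps)
  define c where "c = (if m = 0 then inverse n else inverse m)"
  have "m \<noteq> 0 \<or> n \<noteq> 0" using ab(1) assms by auto
  then have "hnum x = c * n" "hden x = c * m" "c \<noteq> 0"
    by (auto simp: x_def c_def hnum_def hden_def divide_simps)
  then have "bracket x b = c * (n * hden b - hnum b * m)" "bracket x a = c * (n * hden a - hnum a * m)"
    by (simp_all add: bracket_def algebra_simps)
  then have "bracket x b \<noteq> 0" "moebius_coord a b x = z"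
    using assms \<open>c \<noteq> 0\<close> by (simp_all add: ab moebius_coord_def)
  then show ?thesis using that by simp
qed

lemma rsphere_holomorphic_on_moebius_coord:
  assumes "a \<noteq> b" shows "rsphere_holomorphic_on (\<lambda>x. moebius_coord a b x - c) (- {b})"
  unfolding rsphere_holomorphic_on_iff
proof
  have "(\<lambda>z. (z * hden a - hnum a) / (z * hden b - hnum b) - c) holomorphic_on (Some -` (- {b}))"
    by (intro holomorphic_intros) (cases b; auto simp: hnum_def hden_def)
  then show "(\<lambda>x. moebius_coord a b x - c) \<circ> Some holomorphic_on Some -` (- {b})"
    by (simp add: comp_def moebius_coord_def bracket_def) (simp add: hnum_def hden_def)
  have "(\<lambda>w. (hden a - hnum a * w) / (hden b - hnum b * w) - c) holomorphic_on (from_inf -` (- {b}))"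
  proof (intro holomorphic_intros)
    fix w assume "w \<in> from_inf -` (- {b})"
    then show "hden b - hnum b * w \<noteq> 0"
      by (cases b) (auto simp: hnum_def hden_def from_inf_def inverse_eq_divide divide_simps split: if_splits)
  qed
  moreover have "(hden a - hnum a * w) / (hden b - hnum b * w) = moebius_coord a b (from_inf w)" for w
    by (cases "w = 0") (auto simp: moebius_coord_def bracket_def hnum_def hden_def from_inf_def divide_simps)
  ultimately show "(\<lambda>x. moebius_coord a b x - c) \<circ> from_inf holomorphic_on from_inf -` (- {b})"
    by (simp add: comp_def)
qed

lemma local_coordinate_moebius_coord:
  assumes "a \<noteq> b" "p \<noteq> b"
  shows "local_coordinate p (- {b}) (\<lambda>x. moebius_coord a b x - moebius_coord a b p)"
  using assms rsphere_holomorphic_on_moebius_coord[OF assms(1)] inj_on_moebius_coord[OF assms(1)] openin_Compl_singleton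
  by (auto simp: local_coordinate_def inj_on_def)

lemma local_coordinate_moebius_coord_self: "a \<noteq> b \<Longrightarrow> local_coordinate a (- {b}) (moebius_coord a b)"
  using local_coordinate_moebius_coord[of a b a] by simp

text \<open>
  The inverse of the coordinate with pole \<open>q\<close> identifies the complex plane with the complement
  of \<open>q\<close>, and approaching \<open>q\<close> becomes going to infinity. Both limits hold because the inverse of a
  local coordinate is continuous; near \<open>q\<close> that coordinate is the reciprocal.
\<close>

lemma inverse_moebius_coord:
  fixes q q' :: rsphere
  assumes qq: "q \<noteq> q'"
  defines "J \<equiv> inv_into (- {q}) (moebius_coord q' q)"
  shows "J z \<noteq> q" and "moebius_coord q' q (J z) = z"
    and "x \<noteq> q \<Longrightarrow> J (moebius_coord q' q x) = x"
    and "filterlim J (atin rsphere (J z)) (at z)"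
    and "filterlim J (atin rsphere q) at_infinity"
proof -
  have inj: "inj_on (moebius_coord q' q) (- {q})" using inj_on_moebius_coord qq by metis
  have surj: "\<exists>x\<in>- {q}. moebius_coord q' q x = w" for w
    using surj_moebius_coord[of q' q w] qq by (metis ComplI singletonD)
  have J: "J w \<noteq> q" "moebius_coord q' q (J w) = w" for w
    using inv_into_into[of w "moebius_coord q' q" "- {q}"] f_inv_into_f[of w "moebius_coord q' q" "- {q}"] surj[of w]
    by (auto simp: J_def image_iff)
  show "J z \<noteq> q" "moebius_coord q' q (J z) = z" by (fact J)+
  show "J (moebius_coord q' q x) = x" if "x \<noteq> q"
    using that inj by (simp add: J_def)
  have "local_coordinate (J z) (- {q}) (\<lambda>x. moebius_coord q' q x - z)"
    using local_coordinate_moebius_coord[of q' q "J z"] qq J by simp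
  then have l: "filterlim (inv_into (- {q}) (\<lambda>x. moebius_coord q' q x - z)) (atin rsphere (J z)) (at 0)"
    by (rule local_coordinate_inverse_tendsto)
  have "inv_into (- {q}) (\<lambda>x. moebius_coord q' q x - z) (w - z) = J w" for w
    by (intro inv_into_f_eq) (use inj J in \<open>auto simp: inj_on_def\<close>)
  moreover have "filterlim (\<lambda>w. inv_into (- {q}) (\<lambda>x. moebius_coord q' q x - z) (w - z)) (atin rsphere (J z)) (at z)"
    by (subst at_to_0) (simp add: filterlim_filtermap l)
  ultimately show "filterlim J (atin rsphere (J z)) (at z)" by simp
  have "local_coordinate q (- {q'}) (moebius_coord q q')"
    using qq by (rule local_coordinate_moebius_coord_self)
  then have "filterlim (inv_into (- {q'}) (moebius_coord q q')) (atin rsphere q) (at 0)"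
    by (rule local_coordinate_inverse_tendsto)
  then have l: "filterlim (\<lambda>w. inv_into (- {q'}) (moebius_coord q q') (inverse w)) (atin rsphere q) at_infinity"
    by (rule filterlim_compose) (simp add: filterlim_inverse_at_iff filterlim_ident)
  have "inv_into (- {q'}) (moebius_coord q q') (inverse w) = J w" if "w \<noteq> 0" for w
  proof (rule inv_into_f_eq)
    show "inj_on (moebius_coord q q') (- {q'})" using qq by (rule inj_on_moebius_coord)
    show "J w \<in> - {q'}" using J(2)[of w] that by auto
    show "moebius_coord q q' (J w) = inverse w" using J(2)[of w] by (metis moebius_coord_swap)
  qed
  then have "\<forall>\<^sub>F w in at_infinity. inv_into (- {q'}) (moebius_coord q q') (inverse w) = J w"
    by (intro eventually_mono[OF eventually_not_equal_at_infinity[of 0]])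
  from filterlim_cong[OF refl refl this] l show "filterlim J (atin rsphere q) at_infinity"
    by (rule iffD1)
qed

section \<open>Functions of the form C g^k with g rational\<close>

definition monic_of_roots :: "complex set \<Rightarrow> complex \<Rightarrow> complex" where
  "monic_of_roots A z = (\<Prod>a\<in>A. z - a)"

lemma holomorphic_monic_of_roots [holomorphic_intros]: "monic_of_roots A holomorphic_on S"
  unfolding monic_of_roots_def by (intro holomorphic_intros)

lemma monic_of_roots_eq_0_iff: "finite A \<Longrightarrow> monic_of_roots A z = 0 \<longleftrightarrow> z \<in> A"
  by (auto simp: monic_of_roots_def)

lemma monic_of_roots_tendsto: "(monic_of_roots A \<longlongrightarrow> monic_of_roots A z) (at z)"
  unfolding monic_of_roots_def by (intro tendsto_intros)

lemma monic_of_roots_remove: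
  "finite A \<Longrightarrow> a \<in> A \<Longrightarrow> monic_of_roots A z = (z - a) * monic_of_roots (A - {a}) z"
  by (simp add: monic_of_roots_def prod.remove)

lemma monic_of_roots_at_infinity:
  assumes "finite A"
  shows "((\<lambda>z. monic_of_roots A z / z ^ card A) \<longlongrightarrow> 1) at_infinity"
proof -
  have "((\<lambda>z. \<Prod>a\<in>A. 1 - a * inverse z) \<longlongrightarrow> (\<Prod>a\<in>A. 1 - a * 0)) at_infinity"
    by (intro tendsto_intros tendsto_inverse_0)
  moreover have "\<forall>\<^sub>F z in at_infinity. (\<Prod>a\<in>A. 1 - a * inverse z) = monic_of_roots A z / z ^ card A"
    using eventually_not_equal_at_infinity[of 0]
  proof eventually_elim
    case (elim z)
    then have "(\<Prod>a\<in>A. 1 - a * inverse z) = (\<Prod>a\<in>A. (z - a) / z)"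
      by (intro prod.cong) (auto simp: field_simps)
    then show ?case by (simp add: monic_of_roots_def prod_dividef)
  qed
  ultimately show ?thesis by (simp add: Lim_transform_eventually)
qed

lemma monic_of_roots_ratio_at_infinity:
  assumes "finite A" "finite B" "card A = card B"
  shows "((\<lambda>z. monic_of_roots A z / monic_of_roots B z) \<longlongrightarrow> 1) at_infinity"
proof -
  have "((\<lambda>z. (monic_of_roots A z / z ^ card A) / (monic_of_roots B z / z ^ card B)) \<longlongrightarrow> 1 / 1) at_infinity"
    by (intro tendsto_divide monic_of_roots_at_infinity assms) simp
  then have "((\<lambda>z. (monic_of_roots A z / z ^ card A) / (monic_of_roots B z / z ^ card B)) \<longlongrightarrow> 1) at_infinity"
    by simp
  then show ?thesis
  proof (rule Lim_transform_eventually)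
    show "\<forall>\<^sub>F z in at_infinity. monic_of_roots A z / z ^ card A / (monic_of_roots B z / z ^ card B)
        = monic_of_roots A z / monic_of_roots B z"
      using eventually_not_equal_at_infinity[of 0] by eventually_elim (simp add: assms)
  qed
qed

lemma eventually_at_infinity_notin_finite:
  "finite A \<Longrightarrow> \<forall>\<^sub>F z :: complex in at_infinity. z \<notin> A"
proof -
  assume "finite A"
  then obtain b where "\<And>z. z \<in> A \<Longrightarrow> norm z \<le> b" 
    using finite_imp_bounded[of A] by (auto simp: bounded_iff)
  then show ?thesis unfolding eventually_at_infinity
    by (intro exI[of _ "b + 1"]) force
qed

text \<open>Riemann's removable singularity theorem followed by Liouville's theorem.\<close>

lemma constant_of_limits:
  fixes H :: "complex \<Rightarrow> complex"
  assumes K: "finite K" and hol: "H holomorphic_on (- K)"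
    and lim: "\<And>z. z \<in> K \<Longrightarrow> \<exists>L. (H \<longlongrightarrow> L) (at z)"
    and inf: "(H \<longlongrightarrow> C) at_infinity"
    and z: "z \<notin> K"
  shows "H z = C"
proof -
  define G where "G w = (if w \<in> K then Lim (at w) H else H w)" for w
  have G_eq: "G w = H w" if "w \<notin> K" for w using that by (simp add: G_def)
  have oK: "open (- K)" using K by (simp add: finite_imp_closed open_Compl)
  have "G holomorphic_on UNIV"
  proof (rule no_isolated_singularity'[OF _ _ open_UNIV K])
    have "G holomorphic_on (- K)" by (rule holomorphic_transform[OF hol]) (simp add: G_eq)
    then show "G holomorphic_on (UNIV - K)" by (simp add: Compl_eq_Diff_UNIV)
    fix w assume w: "w \<in> K"
    then obtain L where L: "(H \<longlongrightarrow> L) (at w)" using lim by blast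
    then have "Lim (at w) H = L" by (intro tendsto_Lim) auto
    then have "G w = L" using w by (simp add: G_def)
    have "\<forall>\<^sub>F v in at w. v \<in> - (K - {w})"
      using K by (intro eventually_at_in_open' open_Compl finite_imp_closed) auto
    then have "\<forall>\<^sub>F v in at w. H v = G v"
      using eventually_neq_at_within[of w w UNIV]
      by eventually_elim (auto simp: G_def)
    then show "(G \<longlongrightarrow> G w) (at w within UNIV)"
      using L \<open>G w = L\<close> Lim_transform_eventually by auto
  qed
  moreover have "(G \<longlongrightarrow> C) at_infinity"
    using inf by (rule Lim_transform_eventually)
      (use eventually_at_infinity_notin_finite[OF K] in eventually_elim, simp add: G_eq)
  ultimately have "G z = C" by (rule Liouville_weak)
  then show ?thesis using z by (simp add: G_eq)
qed

text \<open>All roots of \<open>monic_of_roots A\<close> are simple, so its \<open>k\<close>-th power cancels a zero of order \<open>k\<close>.\<close>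

lemma limit_divide_monic_power:
  assumes A: "finite A" "a \<in> A"
    and lim: "((\<lambda>w. F w / (w - a) ^ k) \<longlongrightarrow> L) (at a)"
  shows "((\<lambda>w. F w / monic_of_roots A w ^ k) \<longlongrightarrow> L / monic_of_roots (A - {a}) a ^ k) (at a)"
proof -
  have "((\<lambda>w. (F w / (w - a) ^ k) / monic_of_roots (A - {a}) w ^ k)
      \<longlongrightarrow> L / monic_of_roots (A - {a}) a ^ k) (at a)"
    using A by (intro tendsto_intros lim monic_of_roots_tendsto) (simp add: monic_of_roots_eq_0_iff)
  then show ?thesis
    by (simp add: monic_of_roots_remove[OF A] power_mult_distrib)
qed

text \<open>
  The quotient of \<open>F\<close> by the \<open>k\<close>-th power has a finite limit at every point of \<open>A\<close> and \<open>B\<close> and tends to \<open>C\<close> at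
  infinity, so it is constant.
\<close>

lemma eq_constant_times_power:
  assumes fin: "finite A" "finite B" and card: "card A = card B"
    and hol: "F holomorphic_on - B"
    and zeros: "\<And>a. a \<in> A \<Longrightarrow> \<exists>L. ((\<lambda>w. F w / (w - a) ^ k) \<longlongrightarrow> L) (at a)"
    and poles: "\<And>b. b \<in> B \<Longrightarrow> \<exists>L. ((\<lambda>w. F w * (w - b) ^ k) \<longlongrightarrow> L) (at b)"
    and inf: "(F \<longlongrightarrow> C) at_infinity"
    and z: "z \<notin> A" "z \<notin> B"
  shows "F z = C * (monic_of_roots A z / monic_of_roots B z) ^ k"
proof -
  define H where "H w = F w * (monic_of_roots B w / monic_of_roots A w) ^ k" for w
  have "H z = C"
  proof (rule constant_of_limits[of "A \<union> B" H])
    show "H holomorphic_on - (A \<union> B)"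
      unfolding H_def using hol fin
      by (intro holomorphic_intros) (auto simp: monic_of_roots_eq_0_iff elim: holomorphic_on_subset)
    have "(H \<longlongrightarrow> C * 1 ^ k) at_infinity"
      unfolding H_def by (intro tendsto_intros inf monic_of_roots_ratio_at_infinity) (use fin card in auto)
    then show "(H \<longlongrightarrow> C) at_infinity" by simp
    show "\<exists>L. (H \<longlongrightarrow> L) (at w)" if "w \<in> A \<union> B" for w
    proof (cases "w \<in> A")
      case True
      then obtain L where "((\<lambda>v. F v / (v - w) ^ k) \<longlongrightarrow> L) (at w)" using zeros by blast
      note lim = limit_divide_monic_power[OF fin(1) True this]
      have "((\<lambda>v. F v / monic_of_roots A v ^ k * monic_of_roots B v ^ k)
          \<longlongrightarrow> L / monic_of_roots (A - {w}) w ^ k * monic_of_roots B w ^ k) (at w)"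
        by (intro tendsto_mult tendsto_power monic_of_roots_tendsto lim)
      then show ?thesis by (auto simp: H_def[abs_def] power_divide)
    next
      case False
      then have w: "w \<in> B" using that by simp
      then obtain L where L: "((\<lambda>v. F v * (v - w) ^ k) \<longlongrightarrow> L) (at w)" using poles by blast
      have "((\<lambda>v. F v * (v - w) ^ k * (monic_of_roots (B - {w}) v / monic_of_roots A v) ^ k)
          \<longlongrightarrow> L * (monic_of_roots (B - {w}) w / monic_of_roots A w) ^ k) (at w)"
        using False fin by (intro tendsto_intros L monic_of_roots_tendsto) (simp add: monic_of_roots_eq_0_iff)
      then show ?thesis
        by (auto simp: H_def[abs_def] monic_of_roots_remove[OF fin(2) w] power_divide power_mult_distrib mult.assoc)
    qed
  qed (use fin z in auto)
  then show ?thesis using fin z by (auto simp: H_def monic_of_roots_eq_0_iff field_simps)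
qed

text \<open>
  Write \<open>x\<close> for the quotient \<open>P / Q\<close> of the two polynomials. In
  \<open>x^k - 1 = (x - 1) (1 + x + \<dots> + x^(k-1))\<close> the second factor tends to \<open>k \<noteq> 0\<close> at infinity, so \<open>x - 1\<close>
  alone vanishes there to order \<open>m\<close>. Multiplying by \<open>Q\<close>, whose degree is less than \<open>m\<close>, shows
  that \<open>P - Q\<close> tends to \<open>0\<close>. Being entire, it is \<open>0\<close>.
\<close>

lemma monic_of_roots_eqI:
  assumes fin: "finite A" "finite B" and card: "card A = card B"
    and k: "k \<ge> 1" and m: "card A < m"
    and lim: "((\<lambda>z. ((monic_of_roots A z / monic_of_roots B z) ^ k - 1) * z ^ m) \<longlongrightarrow> L) at_infinity"
  shows "monic_of_roots A z = monic_of_roots B z"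
proof -
  define x where "x z = monic_of_roots A z / monic_of_roots B z" for z
  define s where "s z = (\<Sum>i<k. x z ^ i)" for z
  have x: "(x \<longlongrightarrow> 1) at_infinity"
    unfolding x_def by (rule monic_of_roots_ratio_at_infinity[OF fin card])
  have "(s \<longlongrightarrow> (\<Sum>i<k. 1 ^ i)) at_infinity"
    unfolding s_def by (intro tendsto_intros x)
  then have s: "(s \<longlongrightarrow> of_nat k) at_infinity" by simp
  have s0: "\<forall>\<^sub>F z in at_infinity. s z \<noteq> 0"
    using k by (intro tendsto_imp_eventually_ne[OF s]) simp
  have inv: "((\<lambda>z::complex. inverse z ^ (m - card A)) \<longlongrightarrow> 0 ^ (m - card A)) at_infinity"
    by (intro tendsto_intros tendsto_inverse_0)
  have "((\<lambda>z. ((x z ^ k - 1) * z ^ m) / s z * (monic_of_roots B z / z ^ card B) * inverse z ^ (m - card A))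
      \<longlongrightarrow> L / of_nat k * 1 * 0 ^ (m - card A)) at_infinity"
    using k by (intro tendsto_mult tendsto_divide s inv monic_of_roots_at_infinity fin lim[folded x_def]) auto
  then have "((\<lambda>z. ((x z ^ k - 1) * z ^ m) / s z * (monic_of_roots B z / z ^ card B) * inverse z ^ (m - card A))
      \<longlongrightarrow> 0) at_infinity"
    using m by (simp add: power_0_left)
  moreover have "\<forall>\<^sub>F z in at_infinity.
      ((x z ^ k - 1) * z ^ m) / s z * (monic_of_roots B z / z ^ card B) * inverse z ^ (m - card A)
        = monic_of_roots A z - monic_of_roots B z"
    using s0 eventually_at_infinity_notin_finite[OF fin(2)] eventually_not_equal_at_infinity[of 0]
  proof eventually_elim
    case (elim z)
    have "z ^ m = z ^ card B * z ^ (m - card A)"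
      using m card by (simp flip: power_add)
    moreover have "x z ^ k - 1 = (x z - 1) * s z" unfolding s_def by (rule power_diff_1_eq)
    moreover have "z ^ card B * z ^ (m - card A) * inverse z ^ (m - card A) = z ^ card B"
      using elim by (simp add: power_inverse)
    ultimately have "((x z ^ k - 1) * z ^ m) / s z * (monic_of_roots B z / z ^ card B) * inverse z ^ (m - card A)
        = (x z - 1) * monic_of_roots B z"
      using elim by simp
    also have "\<dots> = monic_of_roots A z - monic_of_roots B z"
      using elim fin by (simp add: x_def monic_of_roots_eq_0_iff left_diff_distrib)
    finally show ?case .
  qed
  ultimately have "((\<lambda>z. monic_of_roots A z - monic_of_roots B z) \<longlongrightarrow> 0) at_infinity"
    by (rule Lim_transform_eventually)
  then have "monic_of_roots A z - monic_of_roots B z = 0"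
    by (intro Liouville_weak_0) (intro holomorphic_intros)
  then show ?thesis by simp
qed

text \<open>
  A function with \<open>card A\<close> zeros and equally many poles, all of order \<open>k\<close>, is \<open>C\<close> times the \<open>k\<close>-th
  power of a rational function of degree \<open>card A\<close>. Such a nonconstant rational function cannot
  take a value to an order that exceeds its degree, and hence neither can its power take a nonzero value to that
  order. The point in question is placed at infinity, where the order is a rate of decay.
\<close>

lemma no_high_order_value_of_power:
  fixes F :: "complex \<Rightarrow> complex"
  assumes fin: "finite A" "finite B" and disj: "A \<inter> B = {}" and card: "card A = card B"
    and ne: "A \<noteq> {}" and k: "k \<ge> 1" and C: "C \<noteq> 0" and m: "card A < m"
    and diff: "\<And>z. z \<notin> B \<Longrightarrow> F field_differentiable at z"
    and zeros: "\<And>a. a \<in> A \<Longrightarrow> \<exists>L. ((\<lambda>w. F w / (w - a) ^ k) \<longlongrightarrow> L) (at a)"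
    and poles: "\<And>b. b \<in> B \<Longrightarrow> \<exists>L. ((\<lambda>w. F w * (w - b) ^ k) \<longlongrightarrow> L) (at b)"
    and inf: "((\<lambda>w. (F w - C) * w ^ m) \<longlongrightarrow> L) at_infinity"
  shows False
proof -
  have hol: "F holomorphic_on - B"
    using diff by (auto simp: holomorphic_on_def intro: field_differentiable_at_within)
  have "((\<lambda>w. (F w - C) * w ^ m * inverse w ^ m + C) \<longlongrightarrow> L * 0 ^ m + C) at_infinity"
    by (intro tendsto_intros inf tendsto_inverse_0)
  moreover have "\<forall>\<^sub>F w in at_infinity. (F w - C) * w ^ m * inverse w ^ m + C = F w"
    using eventually_not_equal_at_infinity[of 0]
    by eventually_elim (simp add: field_simps)
  ultimately have "(F \<longlongrightarrow> L * 0 ^ m + C) at_infinity" by (rule Lim_transform_eventually)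
  then have F: "(F \<longlongrightarrow> C) at_infinity" using m by (simp add: power_0_left)
  have "((\<lambda>w. (F w - C) * w ^ m / C) \<longlongrightarrow> L / C) at_infinity"
    using C by (intro tendsto_intros inf)
  moreover have "\<forall>\<^sub>F w in at_infinity. (F w - C) * w ^ m / C
      = ((monic_of_roots A w / monic_of_roots B w) ^ k - 1) * w ^ m"
    using eventually_at_infinity_notin_finite[OF fin(1)] eventually_at_infinity_notin_finite[OF fin(2)]
  proof eventually_elim
    case (elim w)
    show ?case
      using eq_constant_times_power[OF fin card hol zeros poles F elim] C by (simp add: field_simps)
  qed
  ultimately have lim: "((\<lambda>w. ((monic_of_roots A w / monic_of_roots B w) ^ k - 1) * w ^ m) \<longlongrightarrow> L / C) at_infinity"
    by (rule Lim_transform_eventually)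
  obtain a where a: "a \<in> A" "a \<notin> B" using ne disj by blast
  have "monic_of_roots A a = monic_of_roots B a"
    by (rule monic_of_roots_eqI[OF fin card k m lim])
  with a fin show False by (metis monic_of_roots_eq_0_iff)
qed

text \<open>
  For \<open>e = 1\<close> the derivative is \<open>L\<close>, for larger \<open>e\<close> it is \<open>0\<close>. In this way the expansions at the
  single points already give holomorphy.
\<close>

lemma field_differentiable_of_power_limit:
  fixes F :: "complex \<Rightarrow> complex"
  assumes e: "e \<ge> 1" and lim: "((\<lambda>w. (F w - F z) / (w - z) ^ e) \<longlongrightarrow> L) (at z)"
  shows "F field_differentiable at z"
proof -
  have "((\<lambda>w. (F w - F z) / (w - z) ^ e * (w - z) ^ (e - 1)) \<longlongrightarrow> L * (z - z) ^ (e - 1)) (at z)"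
    by (intro tendsto_intros lim)
  moreover have "(F w - F z) / (w - z) ^ e * (w - z) ^ (e - 1) = (F w - F z) / (w - z)" if "w \<noteq> z" for w
    using that e by (cases e) auto
  then have "\<forall>\<^sub>F w in at z. (F w - F z) / (w - z) ^ e * (w - z) ^ (e - 1) = (F w - F z) / (w - z)"
    by (simp add: eventually_at_filter)
  ultimately have "((\<lambda>w. (F w - F z) / (w - z)) \<longlongrightarrow> L * (z - z) ^ (e - 1)) (at z)"
    by (rule Lim_transform_eventually)
  then show ?thesis by (auto simp: field_differentiable_def has_field_derivative_iff)
qed

section \<open>Ramification over a third point\<close>

text \<open>
  Two fibres of \<open>h\<close> points each, with all indices equal to \<open>k\<close>, force \<open>f\<close> to be a constant
  times the \<open>k\<close>-th power of a map of degree \<open>h\<close>, once these two branching points are moved to \<open>0\<close> and infinity. Away from \<open>0\<close> and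
  infinity the power map is unramified, so every other index of \<open>f\<close> is an index of the map of
  degree \<open>h\<close>.
\<close>

lemma ramification_bound_over_third_point:
  assumes f: "branched_cover f d"
    and ne: "p1 \<noteq> p2" "f q \<noteq> p1" "f q \<noteq> p2"
    and k1: "\<And>x. f x = p1 \<Longrightarrow> ramification_index f x = k"
    and k2: "\<And>x. f x = p2 \<Longrightarrow> ramification_index f x = k"
    and card: "card (f -` {p1}) = h" "card (f -` {p2}) = h"
    and pos: "k \<ge> 1" "h \<ge> 1"
  shows "ramification_index f q \<le> h"
proof (rule ccontr)
  assume large: "\<not> ?thesis"
  define m where "m = ramification_index f q"
  have ind: "has_ramification_index f x (ramification_index f x)" for x
    using f by (rule ramification_index_works)
  have cont: "continuous_map rsphere rsphere f"
    using f by (simp add: branched_cover_def holomorphic_rsphere_map_def)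
  \<comment> \<open>Any point other than \<open>q\<close> serves as the origin of the source coordinate.\<close>
  define q' :: rsphere where "q' = (if q = None then Some 0 else None)"
  have qq: "q \<noteq> q'" by (simp add: q'_def)
  define J where "J = inv_into (- {q}) (moebius_coord q' q)"
  note J = inverse_moebius_coord[OF qq, folded J_def]
  have injJ: "inj J" using J(2) by (metis injI)
  define r where "r = moebius_coord p1 p2"
  define F where "F z = r (f (J z))" for z
  define A where "A = J -` (f -` {p1})"
  define B where "B = J -` (f -` {p2})"
  have fin: "finite (f -` {p})" for p using f by (simp add: branched_cover_def has_degree_def)
  have card_J: "card (J -` (f -` {p})) = card (f -` {p})" if "p \<noteq> f q" for p
  proof (rule card_vimage_inj[OF injJ])
    show "f -` {p} \<subseteq> range J" using that J(3) by (metis rangeI subsetI vimage_singleton_eq)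
  qed
  have expand: "\<exists>L. ((\<lambda>w. \<beta> (f (J w)) / (w - z) ^ ramification_index f (J z)) \<longlongrightarrow> L) (at z) \<and> L \<noteq> 0"
    if \<beta>: "local_coordinate (f (J z)) V \<beta>" for z V \<beta>
  proof -
    have \<alpha>: "local_coordinate (J z) (- {q}) (\<lambda>x. moebius_coord q' q x - z)"
      using local_coordinate_moebius_coord[of q' q "J z"] qq J by simp
    obtain L where "L \<noteq> 0" "((\<lambda>y. \<beta> (f y) / (moebius_coord q' q y - z) ^ ramification_index f (J z)) \<longlongrightarrow> L) (atin rsphere (J z))"
      by (rule ramification_index_expansion[OF cont ind \<alpha> \<beta>])
    from filterlim_compose[OF this(2) J(4)] this(1) show ?thesis by (auto simp: J(2))
  qed
  obtain L where L: "((\<lambda>y. (r (f y) - r (f q)) / moebius_coord q q' y ^ m) \<longlongrightarrow> L) (atin rsphere q)"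
    using ramification_index_expansion[OF cont ind local_coordinate_moebius_coord_self[OF qq] local_coordinate_moebius_coord[OF ne(1,3)]]
    by (metis m_def r_def)
  show False
  proof (rule no_high_order_value_of_power)
    show "finite A" "finite B" unfolding A_def B_def by (intro finite_vimageI fin injJ)+
    show "A \<inter> B = {}" using ne by (auto simp: A_def B_def)
    show "card A = card B" "card A < m" "A \<noteq> {}"
      using card_J[of p1] card_J[of p2] card ne pos large by (auto simp: A_def B_def m_def)
    show "k \<ge> 1" by (fact pos)
    show "r (f q) \<noteq> 0" using ne by (simp add: r_def)
    show "F field_differentiable at z" if "z \<notin> B" for z
    proof -
      have "f (J z) \<noteq> p2" using that by (simp add: B_def)
      from expand[OF local_coordinate_moebius_coord[OF ne(1) this]]
      obtain L where "((\<lambda>w. (F w - F z) / (w - z) ^ ramification_index f (J z)) \<longlongrightarrow> L) (at z)"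
        by (auto simp: F_def r_def)
      moreover have "ramification_index f (J z) \<ge> 1" using ind by (simp add: has_ramification_index_def)
      ultimately show ?thesis by (rule field_differentiable_of_power_limit[rotated])
    qed
    show "\<exists>L. ((\<lambda>w. F w / (w - a) ^ k) \<longlongrightarrow> L) (at a)" if "a \<in> A" for a
    proof -
      have a: "f (J a) = p1" using that by (simp add: A_def)
      show ?thesis
        using expand[of a, unfolded a, OF local_coordinate_moebius_coord_self[OF ne(1)]] k1[OF a]
        by (auto simp: F_def r_def)
    qed
    show "\<exists>L. ((\<lambda>w. F w * (w - b) ^ k) \<longlongrightarrow> L) (at b)" if "b \<in> B" for b
    proof -
      have b: "f (J b) = p2" using that by (simp add: B_def)
      obtain L where L: "L \<noteq> 0" "((\<lambda>w. moebius_coord p2 p1 (f (J w)) / (w - b) ^ k) \<longlongrightarrow> L) (at b)"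
        using expand[of b, unfolded b, OF local_coordinate_moebius_coord_self[OF ne(1)[symmetric]]] k2[OF b]
        by auto
      have "((\<lambda>w. inverse (moebius_coord p2 p1 (f (J w)) / (w - b) ^ k)) \<longlongrightarrow> inverse L) (at b)"
        by (intro tendsto_intros L)
      moreover have "inverse (moebius_coord p2 p1 (f (J w)) / (w - b) ^ k) = F w * (w - b) ^ k" for w
        by (simp add: F_def r_def moebius_coord_swap[of p1 p2] divide_inverse)
      ultimately show ?thesis by auto
    qed
    have "(r (f (J w)) - r (f q)) / moebius_coord q q' (J w) ^ m = (F w - r (f q)) * w ^ m" for w
      by (simp add: F_def moebius_coord_swap[of q q'] J(2) divide_inverse power_inverse)
    then show "((\<lambda>w. (F w - r (f q)) * w ^ m) \<longlongrightarrow> L) at_infinity"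
      using filterlim_compose[OF L J(5)] by simp
  qed
qed

theorem corollary4:
  fixes d :: nat
  assumes "d \<ge> 2" and "\<not> prime d"
  shows "\<exists>D. exceptional d D"
proof -
  obtain h k where hk: "d = h * k" "h \<ge> 2" "k \<ge> 2"
  proof -
    obtain h where h: "h dvd d" "h \<noteq> 1" "h \<noteq> d" using assms by (auto simp: prime_nat_iff)
    then obtain k where k: "d = h * k" by (auto elim: dvdE)
    with h assms have "h \<noteq> 0" "k \<noteq> 0" "k \<noteq> 1" by auto
    with that[OF k] h show ?thesis by linarith
  qed
  obtain j where j: "k = j + 2" using hk(3) by (metis le_add_diff_inverse2)
  obtain g where g: "h = g + 2" using hk(2) by (metis le_add_diff_inverse2)
  define D where "D = [replicate h k, replicate h k, (2 * h - 1) # replicate (h * (k - 2) + 1) 1]"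
  have "candidate_branch_datum d D"
    using hk by (auto simp: candidate_branch_datum_def D_def sum_list_replicate j g algebra_simps)
  moreover have False if "realizes f d D" for f
  proof -
    have f: "branched_cover f d" using that by (simp add: realizes_def)
    have len: "length D = 3" by (simp add: D_def)
    obtain ps where ps: "distinct ps" "length ps = 3"
      and fib: "\<And>i. i < 3 \<Longrightarrow> finite (f -` {ps ! i})"
        "\<And>i. i < 3 \<Longrightarrow>
          image_mset (ramification_index f) (mset_set (f -` {ps ! i})) = mset (D ! i)"
      using \<open>realizes f d D\<close> unfolding realizes_def len by blast
    have fib_set: "ramification_index f ` (f -` {ps ! i}) = set (D ! i)"
      and fib_card: "card (f -` {ps ! i}) = length (D ! i)" if "i < 3" for i
      using arg_cong[OF fib(2)[OF that], of set_mset] arg_cong[OF fib(2)[OF that], of size] fib(1)[OF that]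
      by simp_all
    have "2 * h - 1 \<in> ramification_index f ` (f -` {ps ! 2})"
      using fib_set[of 2] by (simp add: D_def)
    then obtain q where q: "f q = ps ! 2" "ramification_index f q = 2 * h - 1" by auto
    have "ramification_index f q \<le> h"
    proof (rule ramification_bound_over_third_point[OF f])
      show "ps ! 0 \<noteq> ps ! 1" "f q \<noteq> ps ! 0" "f q \<noteq> ps ! 1"
        using ps q by (simp_all add: nth_eq_iff_index_eq)
      show "ramification_index f x = k" if "f x = ps ! 0" for x
        using fib_set[of 0] that by (auto simp: D_def)
      show "ramification_index f x = k" if "f x = ps ! 1" for x
        using fib_set[of 1] that by (auto simp: D_def)
      show "card (f -` {ps ! 0}) = h" "card (f -` {ps ! 1}) = h"
        using fib_card[of 0] fib_card[of 1] by (simp_all add: D_def)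
    qed (use hk in auto)
    with q hk show False by simp
  qed
  ultimately show ?thesis unfolding exceptional_def by blast
qed

end
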